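(* The geometric realisation of the infinite random simplicial complex $\mathcal{R}_{SC}$ is homeomorphic to the geometric realisation of the infinite simplex $\Delta^\infty$.
   Context: A simplicial complex on a set $V$ is a set $\Delta$ of finite subsets of $V$ (faces) closed under taking subsets; here every element of $V$ is a vertex (i.e. $\{v\}\in\Delta$ for all $v\in V$). For $W\subseteq V$, the induced subcomplex on $W$ consists of the faces contained in $W$. The infinite random simplicial complex $\mathcal{R}_{SC}$ is the Fra\"iss\'e limit of the class of finite simplicial complexes: the unique up to isomorphism simplicial complex on a countably infinite vertex set such that every finite simplicial complex is isomorphic to an induced subcomplex of it, and which is weakly homogeneous: whenever $A$ is an induced subcomplex of a finite simplicial complex $B$ and $f$ is an isomorphism from $A$ onto an induced subcomplex of $\mathcal{R}_{SC}$, $f$ extends to an isomorphism from $B$ onto an induced subcomplex of $\mathcal{R}_{SC}$. The infinite simplex $\Delta^\infty$ is the simplicial complex on $\mathbb{N}$ whose faces are all finite subsets of $\mathbb{N}$. The geometric realisation $|\Delta|$ of a simplicial complex $\Delta$ on $V$: with $(e_v)_{v\in V}$ the standard basis of $\mathbb{R}^V$, $|\Delta|$ is the union over faces $F\in\Delta$ of the convex hull of $\{e_v:v\in F\}$, and $U\subseteq|\Delta|$ is open iff $U\cap\mathbb{R}^W$ is open for every finite $W\subseteq V$. *)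

theory Defs
  imports "HOL-Analysis.Analysis" "HOL-Analysis.Finite_Function_Topology"
begin

text \<open>A complex is given by its vertex set \<open>V\<close> and its set of faces \<open>D\<close>. The empty face is always
  present; this only matters for \<open>V = {}\<close>, where it makes \<open>{{}}\<close> the unique complex.\<close>

definition abstract_simplicial_complex :: "'a set \<Rightarrow> 'a set set \<Rightarrow> bool" where
  "abstract_simplicial_complex V D \<longleftrightarrow>
     {} \<in> D \<and>
     (\<forall>F\<in>D. finite F \<and> F \<subseteq> V) \<and>
     (\<forall>F\<in>D. \<forall>G. G \<subseteq> F \<longrightarrow> G \<in> D) \<and>
     (\<forall>v\<in>V. {v} \<in> D)"

definition induced_subcomplex :: "'a set set \<Rightarrow> 'a set \<Rightarrow> 'a set set" where
  "induced_subcomplex D W = {F \<in> D. F \<subseteq> W}"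

definition complex_isomorphism ::
    "('a \<Rightarrow> 'b) \<Rightarrow> 'a set \<Rightarrow> 'a set set \<Rightarrow> 'b set \<Rightarrow> 'b set set \<Rightarrow> bool" where
  "complex_isomorphism f V D W E \<longleftrightarrow>
     bij_betw f V W \<and> (\<forall>F. F \<subseteq> V \<longrightarrow> (F \<in> D \<longleftrightarrow> f ` F \<in> E))"

text \<open>The finite complexes tested against are those with vertices in \<open>nat\<close>, which loses nothing up
  to isomorphism: see \<open>universal_complex_any_type\<close> and \<open>weakly_homogeneous_complex_any_type\<close>.\<close>

definition universal_complex :: "'a set \<Rightarrow> 'a set set \<Rightarrow> bool" where
  "universal_complex V D \<longleftrightarrow>
     (\<forall>(B::nat set) DB. finite B \<and> abstract_simplicial_complex B DB \<longrightarrow>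
        (\<exists>f U. U \<subseteq> V \<and> complex_isomorphism f B DB U (induced_subcomplex D U)))"

definition weakly_homogeneous_complex :: "'a set \<Rightarrow> 'a set set \<Rightarrow> bool" where
  "weakly_homogeneous_complex V D \<longleftrightarrow>
     (\<forall>(B::nat set) DB A f U.
        finite B \<and> abstract_simplicial_complex B DB \<and> A \<subseteq> B \<and> U \<subseteq> V \<and>
        complex_isomorphism f A (induced_subcomplex DB A) U (induced_subcomplex D U) \<longrightarrow>
        (\<exists>g U'. U' \<subseteq> V \<and> complex_isomorphism g B DB U' (induced_subcomplex D U') \<and>
                (\<forall>a\<in>A. g a = f a)))"

definition infinite_random_complex :: "'a set \<Rightarrow> 'a set set \<Rightarrow> bool" where
  "infinite_random_complex V D \<longleftrightarrow>
     abstract_simplicial_complex V D \<and> countable V \<and> infinite V \<and>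
     universal_complex V D \<and> weakly_homogeneous_complex V D"

definition infinite_simplex :: "nat set set" where
  "infinite_simplex = {F. finite F}"

text \<open>The realisation lives in the space \<open>'a \<Rightarrow>\<^sub>0 real\<close> of finitely supported functions, with basis
  vectors \<open>Poly_Mapping.single v 1\<close>. Its norm topology is used only on the subspaces
  \<open>coordinate_subspace W\<close> with \<open>W\<close> finite, where it is the Euclidean one.\<close>

definition coordinate_subspace :: "'a set \<Rightarrow> ('a \<Rightarrow>\<^sub>0 real) set" where
  "coordinate_subspace W = {x. Poly_Mapping.keys x \<subseteq> W}"

definition realisation_set :: "'a set set \<Rightarrow> ('a \<Rightarrow>\<^sub>0 real) set" where
  "realisation_set D = (\<Union>F\<in>D. convex hull ((\<lambda>v. Poly_Mapping.single v 1) ` F))"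

definition geometric_realisation :: "'a set \<Rightarrow> 'a set set \<Rightarrow> ('a \<Rightarrow>\<^sub>0 real) topology" where
  "geometric_realisation V D = topology (\<lambda>U.
     U \<subseteq> realisation_set D \<and>
     (\<forall>W. finite W \<and> W \<subseteq> V \<longrightarrow>
        openin (top_of_set (realisation_set D \<inter> coordinate_subspace W))
               (U \<inter> coordinate_subspace W)))"

lemma openin_geometric_realisation:
  "openin (geometric_realisation V D) U \<longleftrightarrow>
     U \<subseteq> realisation_set D \<and>
     (\<forall>W. finite W \<and> W \<subseteq> V \<longrightarrow>
        openin (top_of_set (realisation_set D \<inter> coordinate_subspace W))
               (U \<inter> coordinate_subspace W))"
proof -
  let ?L = "\<lambda>U. U \<subseteq> realisation_set D \<and>
     (\<forall>W. finite W \<and> W \<subseteq> V \<longrightarrow>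
        openin (top_of_set (realisation_set D \<inter> coordinate_subspace W))
               (U \<inter> coordinate_subspace W))"
  have "istopology ?L"
    unfolding istopology_def
  proof (intro conjI allI impI)
    fix S T W assume ST: "?L S" "?L T" and W: "finite W \<and> W \<subseteq> V"
    have "S \<inter> T \<inter> coordinate_subspace W =
        (S \<inter> coordinate_subspace W) \<inter> (T \<inter> coordinate_subspace W)" by blast
    then show "openin (top_of_set (realisation_set D \<inter> coordinate_subspace W))
        (S \<inter> T \<inter> coordinate_subspace W)"
      using ST W by (simp add: openin_Int)
  next
    fix K W assume K: "\<forall>U\<in>K. ?L U" and W: "finite W \<and> W \<subseteq> V"
    have "openin (top_of_set (realisation_set D \<inter> coordinate_subspace W))
        (\<Union>U\<in>K. U \<inter> coordinate_subspace W)"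
      using K W by (intro openin_Union) auto
    then show "openin (top_of_set (realisation_set D \<inter> coordinate_subspace W))
        (\<Union>K \<inter> coordinate_subspace W)"
      by (simp only: Int_Union2)
  qed blast+
  then show ?thesis
    by (simp add: geometric_realisation_def)
qed

lemma topspace_geometric_realisation:
  "topspace (geometric_realisation V D) = realisation_set D"
proof
  show "topspace (geometric_realisation V D) \<subseteq> realisation_set D"
    using openin_geometric_realisation openin_topspace by blast
  have "openin (geometric_realisation V D) (realisation_set D)"
    by (auto simp: openin_geometric_realisation)
  then show "realisation_set D \<subseteq> topspace (geometric_realisation V D)"
    by (rule openin_subset)
qed

lemma complex_isomorphism_induced_iff:
  "complex_isomorphism f A DA U (induced_subcomplex D U) \<longleftrightarrow>
     bij_betw f A U \<and> (\<forall>F. F \<subseteq> A \<longrightarrow> (F \<in> DA \<longleftrightarrow> f ` F \<in> D))"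
  by (auto simp: complex_isomorphism_def induced_subcomplex_def dest: bij_betw_imp_surj_on)

lemma finite_complex_nat_copy:
  fixes B :: "'b set"
  assumes "finite B" "abstract_simplicial_complex B DB"
  obtains h :: "'b \<Rightarrow> nat"
  where "inj_on h B" "finite (h ` B)" "abstract_simplicial_complex (h ` B) ((`) h ` DB)"
    "\<And>F. F \<subseteq> B \<Longrightarrow> h ` F \<in> (`) h ` DB \<longleftrightarrow> F \<in> DB"
proof -
  obtain h :: "'b \<Rightarrow> nat" where h: "inj_on h B"
    using assms(1) finite_imp_inj_to_nat_seg by blast
  have sub: "\<And>F. F \<in> DB \<Longrightarrow> F \<subseteq> B \<and> finite F" "\<And>F G. F \<in> DB \<Longrightarrow> G \<subseteq> F \<Longrightarrow> G \<in> DB"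
    "{} \<in> DB" "\<And>v. v \<in> B \<Longrightarrow> {v} \<in> DB"
    using assms(2) by (auto simp: abstract_simplicial_complex_def)
  have "abstract_simplicial_complex (h ` B) ((`) h ` DB)"
    unfolding abstract_simplicial_complex_def
  proof (intro conjI ballI allI impI)
    show "{} \<in> (`) h ` DB" using sub(3) by force
  next
    fix F assume "F \<in> (`) h ` DB"
    then show "finite F" "F \<subseteq> h ` B" using sub(1) by auto
  next
    fix F G assume "F \<in> (`) h ` DB" "G \<subseteq> F"
    then show "G \<in> (`) h ` DB" using sub(2) by (auto elim!: subset_imageE intro!: imageI)
  next
    fix v assume "v \<in> h ` B"
    then obtain u where "v = h u" "u \<in> B" by blast
    then show "{v} \<in> (`) h ` DB" using imageI[OF sub(4), of u "(`) h"] by simp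
  qed
  moreover have "h ` F \<in> (`) h ` DB \<longleftrightarrow> F \<in> DB" if "F \<subseteq> B" for F
  proof
    assume "h ` F \<in> (`) h ` DB"
    then obtain G where "G \<in> DB" "h ` F = h ` G" by blast
    then show "F \<in> DB" using inj_on_image_eq_iff[OF h that] sub(1) by simp
  qed (rule imageI)
  ultimately show thesis using that h assms(1) by blast
qed

lemma universal_complex_any_type:
  fixes B :: "'b set"
  assumes "universal_complex V D" and B: "finite B" "abstract_simplicial_complex B DB"
  shows "\<exists>f U. U \<subseteq> V \<and> complex_isomorphism f B DB U (induced_subcomplex D U)"
proof -
  obtain h :: "'b \<Rightarrow> nat" where h: "inj_on h B" "finite (h ` B)"
    "abstract_simplicial_complex (h ` B) ((`) h ` DB)"
    and hD: "\<And>F. F \<subseteq> B \<Longrightarrow> h ` F \<in> (`) h ` DB \<longleftrightarrow> F \<in> DB"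
    by (rule finite_complex_nat_copy[OF B]) (rule that)
  have "\<exists>f U. U \<subseteq> V \<and> complex_isomorphism f (h ` B) ((`) h ` DB) U (induced_subcomplex D U)"
    using h(2,3) by (intro assms(1)[unfolded universal_complex_def, rule_format] conjI)
  then obtain f U where U: "U \<subseteq> V"
    and iso: "complex_isomorphism f (h ` B) ((`) h ` DB) U (induced_subcomplex D U)"
    by (elim exE conjE)
  from iso have f: "bij_betw f (h ` B) U"
    and fD: "\<And>F. F \<subseteq> h ` B \<Longrightarrow> F \<in> (`) h ` DB \<longleftrightarrow> f ` F \<in> D"
    unfolding complex_isomorphism_induced_iff by auto
  have "bij_betw (f \<circ> h) B U"
    using bij_betw_trans[OF inj_on_imp_bij_betw[OF h(1)] f] .
  moreover have "F \<in> DB \<longleftrightarrow> (f \<circ> h) ` F \<in> D" if "F \<subseteq> B" for F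
    using that hD fD[of "h ` F"] by (simp add: image_comp image_mono)
  ultimately show ?thesis
    using U unfolding complex_isomorphism_induced_iff by blast
qed

lemma weakly_homogeneous_complex_any_type:
  fixes B :: "'b set"
  assumes "weakly_homogeneous_complex V D" and B: "finite B" "abstract_simplicial_complex B DB"
    and "A \<subseteq> B" "U \<subseteq> V"
    and iso: "complex_isomorphism f A (induced_subcomplex DB A) U (induced_subcomplex D U)"
  shows "\<exists>g U'. U' \<subseteq> V \<and> complex_isomorphism g B DB U' (induced_subcomplex D U') \<and>
           (\<forall>a\<in>A. g a = f a)"
proof -
  obtain h :: "'b \<Rightarrow> nat" where h: "inj_on h B" "finite (h ` B)"
    "abstract_simplicial_complex (h ` B) ((`) h ` DB)"
    and hD: "\<And>F. F \<subseteq> B \<Longrightarrow> h ` F \<in> (`) h ` DB \<longleftrightarrow> F \<in> DB"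
    by (rule finite_complex_nat_copy[OF B]) (rule that)
  define k where "k = inv_into B h"
  have kh: "\<And>b. b \<in> B \<Longrightarrow> k (h b) = b" using h(1) by (simp add: k_def)
  have f: "bij_betw f A U" "\<And>F. F \<subseteq> A \<Longrightarrow> F \<in> DB \<longleftrightarrow> f ` F \<in> D"
    using iso unfolding complex_isomorphism_induced_iff by (auto simp: induced_subcomplex_def)
  have kA: "bij_betw k (h ` A) A"
    using kh \<open>A \<subseteq> B\<close> by (intro bij_betwI[where g = h]) auto
  have "complex_isomorphism (f \<circ> k) (h ` A) (induced_subcomplex ((`) h ` DB) (h ` A)) U
          (induced_subcomplex D U)"
    unfolding complex_isomorphism_induced_iff
  proof (intro conjI allI impI)
    show "bij_betw (f \<circ> k) (h ` A) U" using kA f(1) by (rule bij_betw_trans)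
    fix F assume F: "F \<subseteq> h ` A"
    then obtain G where G: "F = h ` G" "G \<subseteq> A" by (meson subset_imageE)
    then have "k ` F = G" using kh \<open>A \<subseteq> B\<close> by (force simp: image_iff)
    then have "(f \<circ> k) ` F = f ` G" by (metis image_comp)
    then show "F \<in> induced_subcomplex ((`) h ` DB) (h ` A) \<longleftrightarrow> (f \<circ> k) ` F \<in> D"
      using F G hD[of G] f(2)[of G] \<open>A \<subseteq> B\<close> by (auto simp: induced_subcomplex_def)
  qed
  moreover have "h ` A \<subseteq> h ` B" using \<open>A \<subseteq> B\<close> by blast
  ultimately have "\<exists>g U'. U' \<subseteq> V \<and>
      complex_isomorphism g (h ` B) ((`) h ` DB) U' (induced_subcomplex D U') \<and>
      (\<forall>a\<in>h ` A. g a = (f \<circ> k) a)"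
    using h(2,3) \<open>U \<subseteq> V\<close>
    by (intro assms(1)[unfolded weakly_homogeneous_complex_def, rule_format] conjI)
  then obtain g U' where U': "U' \<subseteq> V"
    and iso': "complex_isomorphism g (h ` B) ((`) h ` DB) U' (induced_subcomplex D U')"
    and gf: "\<forall>a\<in>h ` A. g a = (f \<circ> k) a"
    by (elim exE conjE)
  from iso' have g: "bij_betw g (h ` B) U'"
    and gD: "\<And>F. F \<subseteq> h ` B \<Longrightarrow> F \<in> (`) h ` DB \<longleftrightarrow> g ` F \<in> D"
    unfolding complex_isomorphism_induced_iff by auto
  have "bij_betw (g \<circ> h) B U'"
    using bij_betw_trans[OF inj_on_imp_bij_betw[OF h(1)] g] .
  moreover have "F \<in> DB \<longleftrightarrow> (g \<circ> h) ` F \<in> D" if "F \<subseteq> B" for F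
    using that hD gD[of "h ` F"] by (simp add: image_comp image_mono)
  moreover have "\<forall>a\<in>A. (g \<circ> h) a = f a" using gf kh \<open>A \<subseteq> B\<close> by auto
  ultimately show ?thesis
    using U' unfolding complex_isomorphism_induced_iff by blast
qed

text \<open>The infinite random complex exists. On \<open>nat\<close>, the binary expansion of \<open>n\<close> codes the set of
  those \<open>G \<subseteq> {..<n}\<close> for which \<open>insert n G\<close> is allowed to be a face.\<close>

lemma infinite_random_complex_exists: "\<exists>D. infinite_random_complex (UNIV :: nat set) D"
proof -
  define S :: "nat \<Rightarrow> nat set set" where "S n = insert {} (set_decode ` set_decode n)" for n
  define D where "D = {F. finite F \<and> (\<forall>n\<in>F. \<forall>G. G \<subseteq> F \<inter> {..<n} \<longrightarrow> G \<in> S n)}"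
  have D: "abstract_simplicial_complex UNIV D"
    unfolding abstract_simplicial_complex_def
  proof (intro conjI ballI allI impI)
    show "{} \<in> D" by (simp add: D_def)
    show "finite F" if "F \<in> D" for F using that by (simp add: D_def)
    show "F \<subseteq> UNIV" for F :: "nat set" by simp
    show "G \<in> D" if F: "F \<in> D" and G: "G \<subseteq> F" for F G
    proof -
      have "finite G" using F G by (auto simp: D_def intro: finite_subset)
      moreover have "H \<in> S n" if "n \<in> G" "H \<subseteq> G \<inter> {..<n}" for n H
      proof -
        have "n \<in> F" "H \<subseteq> F \<inter> {..<n}" using that G by auto
        then show ?thesis using F by (simp add: D_def)
      qed
      ultimately show ?thesis by (simp add: D_def)
    qed
    show "{v} \<in> D" for v by (auto simp: D_def S_def)
  qed
  have point: "\<exists>n. n \<notin> W \<and> (\<forall>G. G \<subseteq> W \<longrightarrow> (insert n G \<in> D \<longleftrightarrow> G \<in> L))"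
    if W: "finite W" and L: "L \<subseteq> Pow W" "{} \<in> L" "L \<subseteq> D"
      and down: "\<And>G H. G \<in> L \<Longrightarrow> H \<subseteq> G \<Longrightarrow> H \<in> L" for W L
  proof -
    obtain M where "\<forall>w\<in>W. w < M"
      using W finite_nat_set_iff_bounded[of W] by auto
    then have M: "\<And>w. w \<in> W \<Longrightarrow> w < M" by simp
    let ?L = "insert {M} L"
    define n where "n = set_encode (set_encode ` ?L)"
    have finL: "finite L" using finite_subset[OF L(1)] W by simp
    have fin: "finite G" if "G \<in> ?L" for G
      using that L(1) W by (auto intro: finite_subset)
    have dec: "set_decode n = set_encode ` ?L"
      unfolding n_def using finL by (intro set_encode_inverse) simp
    have "(\<lambda>G. set_decode (set_encode G)) ` ?L = (\<lambda>G. G) ` ?L"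
      by (rule image_cong) (simp_all only: fin set_encode_inverse)
    then have "set_decode ` set_decode n = ?L"
      by (simp only: dec image_image image_ident)
    then have Sn: "S n = ?L" using L(2) by (auto simp: S_def)
    have "2 ^ M \<in> set_decode n"
      by (simp add: dec set_encode_def)
    then have "(2::nat) ^ (2 ^ M) \<le> n"
      by (cases "n < 2 ^ (2 ^ M)") (auto simp: set_decode_def)
    moreover have "M < 2 ^ M" "(2::nat) ^ M < 2 ^ (2 ^ M)" by simp_all
    ultimately have Mn: "M < n" by linarith
    have "insert n G \<in> D \<longleftrightarrow> G \<in> L" if G: "G \<subseteq> W" for G
    proof
      have lt: "g < n" if "g \<in> G" for g using that G M Mn by fastforce
      {
        assume "insert n G \<in> D"
        moreover have "G \<subseteq> insert n G \<inter> {..<n}" using lt by auto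
        ultimately have "G \<in> S n" by (auto simp: D_def)
        moreover have "G \<noteq> {M}" using G M by blast
        ultimately show "G \<in> L" using Sn by simp
      next
        assume GL: "G \<in> L"
        have "H \<in> S m" if m: "m \<in> insert n G" and H: "H \<subseteq> insert n G \<inter> {..<m}" for m H
        proof (cases "m = n")
          case True
          then have "H \<subseteq> G" using H by auto
          then show ?thesis using down[OF GL] Sn True by simp
        next
          case False
          then have "m \<in> G" "H \<subseteq> G \<inter> {..<m}" using m H lt[of m] by auto
          moreover have "G \<in> D" using GL L(3) by blast
          ultimately show ?thesis by (simp add: D_def)
        qed
        moreover have "finite G" using GL fin by simp
        ultimately show "insert n G \<in> D" by (simp add: D_def)
      }
    qed
    moreover have "n \<notin> W" using M[of n] Mn by auto
    ultimately show ?thesis by blast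
  qed
  have ext: "\<exists>g. inj_on g (A \<union> X) \<and> (\<forall>F. F \<subseteq> A \<union> X \<longrightarrow> (F \<in> DB \<longleftrightarrow> g ` F \<in> D)) \<and> (\<forall>a\<in>A. g a = f a)"
    if "finite X" and A: "finite A" "A \<inter> X = {}" "A \<union> X \<subseteq> B" and B: "abstract_simplicial_complex B DB"
      and f: "inj_on f A" "\<And>F. F \<subseteq> A \<Longrightarrow> F \<in> DB \<longleftrightarrow> f ` F \<in> D"
    for A B X :: "nat set" and DB and f :: "nat \<Rightarrow> nat"
    using \<open>finite X\<close> A(2,3)
  proof (induction X)
    case empty
    then show ?case using f by auto
  next
    case (insert x X)
    let ?A = "A \<union> X"
    obtain g where g: "inj_on g ?A" "\<And>F. F \<subseteq> ?A \<Longrightarrow> F \<in> DB \<longleftrightarrow> g ` F \<in> D" "\<forall>a\<in>A. g a = f a"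
      using insert.IH insert.prems by auto
    have x: "x \<notin> ?A" using insert by auto
    have downB: "\<And>F G. F \<in> DB \<Longrightarrow> G \<subseteq> F \<Longrightarrow> G \<in> DB"
      using B by (auto simp: abstract_simplicial_complex_def)
    define L where "L = {g ` G | G. G \<subseteq> ?A \<and> insert x G \<in> DB}"
    have xB: "{x} \<in> DB" using B insert.prems by (auto simp: abstract_simplicial_complex_def)
    have inL: "g ` G \<in> L \<longleftrightarrow> insert x G \<in> DB" if "G \<subseteq> ?A" for G
    proof
      assume "g ` G \<in> L"
      then obtain H where "H \<subseteq> ?A" "insert x H \<in> DB" "g ` G = g ` H" by (auto simp: L_def)
      then show "insert x G \<in> DB" using inj_on_image_eq_iff[OF g(1) that] by simp
    qed (use that in \<open>auto simp: L_def\<close>)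
    have "\<exists>n. n \<notin> g ` ?A \<and> (\<forall>G. G \<subseteq> g ` ?A \<longrightarrow> (insert n G \<in> D \<longleftrightarrow> G \<in> L))"
    proof (rule point)
      show "finite (g ` ?A)" using A(1) insert.hyps by simp
      show "L \<subseteq> Pow (g ` ?A)" by (auto simp: L_def)
      show "{} \<in> L" using inL[of "{}"] xB by simp
      show "L \<subseteq> D" using g(2) downB by (auto simp: L_def)
      show "H \<in> L" if G: "G \<in> L" and H: "H \<subseteq> G" for G H
      proof -
        obtain G' where G': "G = g ` G'" "G' \<subseteq> ?A" "insert x G' \<in> DB" using G by (auto simp: L_def)
        obtain H' where H': "H = g ` H'" "H' \<subseteq> G'" using H G'(1) by (auto elim: subset_imageE)
        have "insert x H' \<in> DB" using downB[OF G'(3), of "insert x H'"] H'(2) by auto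
        then show ?thesis using inL[of H'] H' G'(2) by auto
      qed
    qed
    then obtain n where n: "n \<notin> g ` ?A" "\<And>G. G \<subseteq> g ` ?A \<Longrightarrow> insert n G \<in> D \<longleftrightarrow> G \<in> L" by blast
    let ?h = "g(x := n)"
    have hg: "?h ` G = g ` G" if "G \<subseteq> ?A" for G
      using that x by (intro image_cong) auto
    have "inj_on ?h (A \<union> insert x X)"
      using g(1) n(1) x hg[of ?A] by (simp add: inj_on_fun_updI)
    moreover have "F \<in> DB \<longleftrightarrow> ?h ` F \<in> D" if F: "F \<subseteq> A \<union> insert x X" for F
    proof (cases "x \<in> F")
      case False
      then have "F \<subseteq> ?A" using F by auto
      then show ?thesis using g(2) hg by simp
    next
      case True
      define G where "G = F - {x}"
      have G: "G \<subseteq> ?A" "F = insert x G" using True F by (auto simp: G_def)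
      have "?h ` F = insert n (g ` G)" by (simp only: G(2) image_insert hg[OF G(1)] fun_upd_same)
      then show ?thesis using n(2)[of "g ` G"] inL[OF G(1)] G by (simp add: image_mono)
    qed
    moreover have "\<forall>a\<in>A. ?h a = f a" using g(3) x by auto
    ultimately show ?case by blast
  qed
  have hom: "weakly_homogeneous_complex UNIV D"
    unfolding weakly_homogeneous_complex_def
  proof (intro allI impI, elim conjE)
    fix B DB A U and f :: "nat \<Rightarrow> nat"
    assume B: "finite B" "abstract_simplicial_complex B DB" "A \<subseteq> B"
      and iso: "complex_isomorphism f A (induced_subcomplex DB A) U (induced_subcomplex D U)"
    have f: "inj_on f A" "\<And>F. F \<subseteq> A \<Longrightarrow> F \<in> DB \<longleftrightarrow> f ` F \<in> D"
      using iso unfolding complex_isomorphism_induced_iff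
      by (auto simp: induced_subcomplex_def bij_betw_def)
    have AB: "A \<union> (B - A) = B" using B(3) by blast
    have "\<exists>g. inj_on g (A \<union> (B - A)) \<and>
        (\<forall>F. F \<subseteq> A \<union> (B - A) \<longrightarrow> (F \<in> DB \<longleftrightarrow> g ` F \<in> D)) \<and> (\<forall>a\<in>A. g a = f a)"
      by (rule ext[OF _ _ _ _ B(2) f]) (use B in \<open>auto intro: finite_subset\<close>)
    then obtain g where "inj_on g B" "\<And>F. F \<subseteq> B \<Longrightarrow> F \<in> DB \<longleftrightarrow> g ` F \<in> D" "\<forall>a\<in>A. g a = f a"
      unfolding AB by blast
    then have "g ` B \<subseteq> UNIV \<and> complex_isomorphism g B DB (g ` B) (induced_subcomplex D (g ` B)) \<and>
        (\<forall>a\<in>A. g a = f a)"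
      unfolding complex_isomorphism_induced_iff by (simp add: inj_on_imp_bij_betw)
    then show "\<exists>g U'. U' \<subseteq> UNIV \<and> complex_isomorphism g B DB U' (induced_subcomplex D U') \<and>
        (\<forall>a\<in>A. g a = f a)" by blast
  qed
  have "universal_complex UNIV D"
    unfolding universal_complex_def
  proof (intro allI impI)
    fix B :: "nat set" and DB assume B: "finite B \<and> abstract_simplicial_complex B DB"
    then have "{} \<in> DB" by (simp add: abstract_simplicial_complex_def)
    moreover have "{} \<in> D" by (simp add: D_def)
    ultimately have "complex_isomorphism id {} (induced_subcomplex DB {}) {} (induced_subcomplex D {})"
      by (simp add: complex_isomorphism_def induced_subcomplex_def)
    then show "\<exists>f U. U \<subseteq> UNIV \<and> complex_isomorphism f B DB U (induced_subcomplex D U)"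
      using hom[unfolded weakly_homogeneous_complex_def, rule_format, of B DB "{}" "{}" id] B
      by blast
  qed
  then show ?thesis
    using D hom unfolding infinite_random_complex_def by auto
qed

end

theory Submission
  imports Defs
begin

text \<open>Both complexes have the property that every finite subcomplex on a vertex set \<open>A\<close> can be joined,
  inside the complex, with simplices of arbitrary dimension on new vertices \<open>L\<close>. This makes the
  realisation an absolute extensor for embeddings: an embedding \<open>f\<close> of a compact \<open>Y \<subseteq> Z\<close> into the
  subcomplex on \<open>A\<close>, where \<open>Z\<close> is a finite complex, extends to an embedding of \<open>Z\<close>. Indeed, extend the
  coordinates of \<open>f\<close> by Tietze, truncate them so that their support becomes a face, put a copy of
  \<open>z \<in> Z\<close> scaled by its distance to \<open>Y\<close> on the new vertices \<open>L\<close>, and normalise; the \<open>L\<close>-coordinates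
  determine \<open>z\<close> off \<open>Y\<close>. A back-and-forth construction that alternately extends embeddings and their
  inverses over larger finite subcomplexes then yields a homeomorphism, since both realisations carry
  the colimit topology.\<close>

section \<open>Barycentric coordinates and finite stages of the realisation\<close>

lemma lookup_scaleR:
  "Poly_Mapping.lookup (r *\<^sub>R x) i = r *\<^sub>R Poly_Mapping.lookup x i"
proof -
  have "finite {i. r *\<^sub>R Poly_Mapping.lookup x i \<noteq> 0}"
    by (rule finite_subset[OF _ finite_keys[of x]]) (auto simp: in_keys_iff)
  then show ?thesis
    by (simp add: scaleR_poly_mapping_def lookup_Abs_poly_mapping)
qed

text \<open>The metric is the l1 metric, a sum over the two supports, and a single coordinate
  contributes one summand. This is what makes coordinates continuous.\<close>

lemma dist_lookup_le:
  "dist (Poly_Mapping.lookup x v) (Poly_Mapping.lookup y v) \<le> dist x y"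
proof (cases "v \<in> Poly_Mapping.keys x \<union> Poly_Mapping.keys y")
  case True
  then show ?thesis
    unfolding dist_poly_mapping_def by (intro member_le_sum) auto
next
  case False
  then show ?thesis
    by (simp add: in_keys_iff)
qed

lemma continuous_on_lookup [continuous_intros]:
  assumes "continuous_on S f"
  shows "continuous_on S (\<lambda>x. Poly_Mapping.lookup (f x) v)"
proof -
  have "continuous_on UNIV (\<lambda>x. Poly_Mapping.lookup x v)"
    unfolding continuous_on_iff by (meson dist_lookup_le le_less_trans)
  then show ?thesis
    using continuous_on_compose2[OF _ assms] by blast
qed

lemma continuous_on_Min_image:
  fixes c :: "'i \<Rightarrow> 'a::topological_space \<Rightarrow> 'b::linorder_topology"
  assumes "finite N" "N \<noteq> {}" "\<And>v. v \<in> N \<Longrightarrow> continuous_on S (c v)"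
  shows "continuous_on S (\<lambda>z. Min ((\<lambda>v. c v z) ` N))"
  using assms by (induction N rule: finite_ne_induct) (auto intro!: continuous_on_min)

text \<open>Writing the point as a finite sum of scaled basis vectors lets continuity of a map into
  the realisation be checked coordinate by coordinate.\<close>

definition point_of :: "'a set \<Rightarrow> ('a \<Rightarrow> real) \<Rightarrow> ('a \<Rightarrow>\<^sub>0 real)" where
  "point_of W c = (\<Sum>v\<in>W. c v *\<^sub>R Poly_Mapping.single v 1)"

lemma lookup_point_of:
  "finite W \<Longrightarrow> Poly_Mapping.lookup (point_of W c) v = (if v \<in> W then c v else 0)"
  by (simp add: point_of_def lookup_sum lookup_scaleR lookup_single when_def if_distrib
      cong: if_cong)

lemma keys_point_of: "finite W \<Longrightarrow> Poly_Mapping.keys (point_of W c) = {v \<in> W. c v \<noteq> 0}"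
  by (auto simp: in_keys_iff lookup_point_of split: if_splits)

lemma point_of_lookup:
  "finite W \<Longrightarrow> Poly_Mapping.keys x \<subseteq> W \<Longrightarrow> point_of W (Poly_Mapping.lookup x) = x"
  by (rule poly_mapping_eqI) (auto simp: lookup_point_of in_keys_iff)

lemma sum_lookup_superset:
  assumes "finite W" "Poly_Mapping.keys x \<subseteq> W"
  shows "sum (Poly_Mapping.lookup x) W = sum (Poly_Mapping.lookup x) (Poly_Mapping.keys x)"
  using assms by (intro sum.mono_neutral_right) (auto simp: in_keys_iff)

text \<open>Faces are closed under subsets, so the support of a convex combination over a face is
  again a face. Conversely, the coordinates of \<open>x\<close> are convex weights on its own
  support. Convex hulls can thus be replaced by conditions on coordinates.\<close>

lemma realisation_set_iff:
  assumes "abstract_simplicial_complex V D"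
  shows "x \<in> realisation_set D \<longleftrightarrow> Poly_Mapping.keys x \<in> D \<and> (\<forall>v. 0 \<le> Poly_Mapping.lookup x v) \<and>
    sum (Poly_Mapping.lookup x) (Poly_Mapping.keys x) = 1" (is "?l \<longleftrightarrow> ?r")
proof
  assume ?l
  then obtain F where F: "F \<in> D" "x \<in> convex hull ((\<lambda>v. Poly_Mapping.single v 1) ` F)"
    by (auto simp: realisation_set_def)
  have fin: "finite F" and down: "\<And>G. G \<subseteq> F \<Longrightarrow> G \<in> D"
    using assms F(1) by (auto simp: abstract_simplicial_complex_def)
  have inj: "inj_on (\<lambda>v. Poly_Mapping.single v (1::real)) F"
    by (metis (no_types, lifting) inj_onI lookup_single_eq lookup_single_not_eq zero_neq_one)
  obtain u where u: "\<forall>s\<in>(\<lambda>v. Poly_Mapping.single v 1) ` F. 0 \<le> u s"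
    "sum u ((\<lambda>v. Poly_Mapping.single v 1) ` F) = 1"
    "(\<Sum>s\<in>(\<lambda>v. Poly_Mapping.single v 1) ` F. u s *\<^sub>R s) = x"
    using F(2) fin by (auto simp: convex_hull_finite)
  define c where "c v = u (Poly_Mapping.single v 1)" for v
  have x: "x = point_of F c"
    using u(3) inj by (simp add: sum.reindex point_of_def c_def)
  have c: "\<forall>v\<in>F. 0 \<le> c v" "sum c F = 1"
    using u(1,2) inj by (auto simp: sum.reindex c_def)
  have k: "Poly_Mapping.keys x \<subseteq> F"
    using fin by (auto simp: x keys_point_of)
  have "sum (Poly_Mapping.lookup x) F = 1"
    using fin c by (simp add: x lookup_point_of)
  then show ?r
    using k down c sum_lookup_superset[OF fin k] by (simp add: x lookup_point_of[OF fin])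
next
  assume r: ?r
  let ?F = "Poly_Mapping.keys x"
  have "x = (\<Sum>v\<in>?F. Poly_Mapping.lookup x v *\<^sub>R Poly_Mapping.single v 1)"
    using point_of_lookup[of ?F x] by (simp add: point_of_def)
  also have "\<dots> \<in> convex hull ((\<lambda>v. Poly_Mapping.single v 1) ` ?F)"
    using r by (intro convex_sum) (auto intro: hull_inc)
  finally show ?l
    using r by (auto simp: realisation_set_def)
qed

text \<open>For finite \<open>W\<close> contained in the vertex set, these are the stages whose
  colimit topology the realisation carries.\<close>

definition realisation_on :: "'a set set \<Rightarrow> 'a set \<Rightarrow> ('a \<Rightarrow>\<^sub>0 real) set" where
  "realisation_on D W = realisation_set D \<inter> coordinate_subspace W"

lemma realisation_on_iff:
  assumes "abstract_simplicial_complex V D" "finite W"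
  shows "x \<in> realisation_on D W \<longleftrightarrow> Poly_Mapping.keys x \<in> D \<and> Poly_Mapping.keys x \<subseteq> W \<and>
    (\<forall>v. 0 \<le> Poly_Mapping.lookup x v) \<and> sum (Poly_Mapping.lookup x) W = 1"
  using sum_lookup_superset[OF assms(2), of x]
  by (auto simp: realisation_on_def realisation_set_iff[OF assms(1)] coordinate_subspace_def)

lemma realisation_on_subset: "realisation_on D S \<subseteq> realisation_set D"
  by (simp add: realisation_on_def)

lemma realisation_on_mono: "W \<subseteq> W' \<Longrightarrow> realisation_on D W \<subseteq> realisation_on D W'"
  by (auto simp: realisation_on_def coordinate_subspace_def)

lemma realisation_on_empty:
  "abstract_simplicial_complex V D \<Longrightarrow> realisation_on D {} = {}"
  by (auto simp: realisation_on_iff)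

text \<open>Only finitely many faces lie in \<open>W\<close>, and each has a compact convex
  hull.\<close>

lemma compact_realisation_on:
  assumes D: "abstract_simplicial_complex V D" and W: "finite W"
  shows "compact (realisation_on D W)"
proof -
  have "realisation_on D W = (\<Union>F\<in>D \<inter> Pow W. convex hull ((\<lambda>v. Poly_Mapping.single v 1) ` F))"
    (is "_ = ?R")
  proof (rule set_eqI)
    fix x
    let ?D = "D \<inter> Pow W"
    \<comment> \<open>Since \<open>W\<close> need not lie in \<open>V\<close>, the induced
      subcomplex has vertex set \<open>V \<inter> W\<close>. Its realisation satisfies the same
      coordinate conditions.\<close>
    have "abstract_simplicial_complex (V \<inter> W) ?D"
      using D by (auto simp: abstract_simplicial_complex_def)
    from realisation_set_iff[OF this] realisation_set_iff[OF D]
    show "x \<in> realisation_on D W \<longleftrightarrow> x \<in> ?R"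
      by (auto simp: realisation_on_def coordinate_subspace_def realisation_set_def[symmetric])
  qed
  moreover have "finite F" if "F \<in> D" for F
    using D that by (auto simp: abstract_simplicial_complex_def)
  ultimately show ?thesis
    using W by (auto intro!: compact_UN finite_imp_compact_convex_hull)
qed

section \<open>Complexes in which finite subcomplexes can be joined with simplices\<close>

text \<open>The last clause puts the join of the subcomplex on \<open>A\<close> with the full
  simplex on \<open>L\<close> inside \<open>D\<close>; the case of the empty face makes
  \<open>L\<close> itself a face.\<close>

definition joinable_complex :: "'a set \<Rightarrow> 'a set set \<Rightarrow> bool" where
  "joinable_complex V D \<longleftrightarrow> abstract_simplicial_complex V D \<and>
     (\<forall>A n. finite A \<and> A \<subseteq> V \<longrightarrow>
        (\<exists>L. finite L \<and> card L = n \<and> L \<subseteq> V \<and> L \<inter> A = {} \<and> (\<forall>F\<in>D. F \<subseteq> A \<longrightarrow> F \<union> L \<in> D)))"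

lemma joinable_infinite_simplex: "joinable_complex UNIV infinite_simplex"
  unfolding joinable_complex_def
proof (intro conjI allI impI)
  show "abstract_simplicial_complex UNIV infinite_simplex"
    by (auto simp: abstract_simplicial_complex_def infinite_simplex_def intro: finite_subset)
  fix A :: "nat set" and n assume "finite A \<and> A \<subseteq> UNIV"
  then have "infinite (- A)" by (simp add: finite_compl)
  then obtain L where "finite L" "card L = n" "L \<subseteq> - A"
    using infinite_arbitrarily_large by blast
  then show "\<exists>L. finite L \<and> card L = n \<and> L \<subseteq> UNIV \<and> L \<inter> A = {} \<and>
      (\<forall>F\<in>infinite_simplex. F \<subseteq> A \<longrightarrow> F \<union> L \<in> infinite_simplex)"
    by (intro exI[of _ L]) (auto simp: infinite_simplex_def)
qed

text \<open>The join of the subcomplex on \<open>A\<close> with an abstract simplex on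
  \<open>n\<close> vertices is a finite complex. Weak homogeneity extends the identity of
  \<open>A\<close> to it, and the images of the additional vertices form \<open>L\<close>.\<close>

lemma joinable_infinite_random_complex:
  assumes "infinite_random_complex V D"
  shows "joinable_complex V D"
  unfolding joinable_complex_def
proof (intro conjI allI impI)
  show D: "abstract_simplicial_complex V D"
    using assms by (simp add: infinite_random_complex_def)
  have hom: "weakly_homogeneous_complex V D"
    using assms by (simp add: infinite_random_complex_def)
  fix A n assume A: "finite A \<and> A \<subseteq> V"
  \<comment> \<open>The sum type keeps the vertices \<open>Inr i\<close> apart from those of
    \<open>A\<close>. Below, \<open>DB\<close> is the join: only the \<open>A\<close>-part of a set
    decides whether it is a face.\<close>
  define B :: "('a + nat) set" where "B = Inl ` A \<union> Inr ` {..<n}"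
  define DB where "DB = {F. F \<subseteq> B \<and> Inl -` F \<in> D}"
  have finB: "finite B" using A by (simp add: B_def)
  have DB: "abstract_simplicial_complex B DB"
    unfolding abstract_simplicial_complex_def
  proof (intro conjI ballI allI impI)
    show "{} \<in> DB" using D by (simp add: DB_def abstract_simplicial_complex_def)
    show "finite F" if "F \<in> DB" for F
      using that finB by (auto simp: DB_def intro: finite_subset)
    show "F \<subseteq> B" if "F \<in> DB" for F using that by (simp add: DB_def)
    show "G \<in> DB" if "F \<in> DB" "G \<subseteq> F" for F G
    proof -
      have "Inl -` G \<subseteq> Inl -` F" using that by blast
      then show ?thesis using that D by (auto simp: DB_def abstract_simplicial_complex_def)
    qed
    fix v assume v: "v \<in> B"
    have "Inl -` {v} \<in> D"
    proof (cases v)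
      case (Inl a)
      then have "Inl -` {v} = {a}" by auto
      then show ?thesis using v Inl A D by (auto simp: B_def abstract_simplicial_complex_def)
    next
      case (Inr i)
      then have "Inl -` {v} = {}" by auto
      then show ?thesis using D by (auto simp: abstract_simplicial_complex_def)
    qed
    then show "{v} \<in> DB" using v by (simp add: DB_def)
  qed
  define p :: "'a + nat \<Rightarrow> 'a" where "p = case_sum id (\<lambda>_. undefined)"
  have iso: "complex_isomorphism p (Inl ` A) (induced_subcomplex DB (Inl ` A)) A (induced_subcomplex D A)"
    unfolding complex_isomorphism_induced_iff
  proof (intro conjI allI impI)
    show "bij_betw p (Inl ` A) A"
      by (rule bij_betwI[where g = Inl]) (auto simp: p_def)
    fix F assume "F \<subseteq> (Inl ` A :: ('a + nat) set)"
    then obtain G where G: "F = Inl ` G" "G \<subseteq> A" by (meson subset_imageE)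
    moreover have "Inl -` (Inl ` G :: ('a + nat) set) = G" "p ` Inl ` G = G"
      by (auto simp: p_def image_image)
    ultimately show "F \<in> induced_subcomplex DB (Inl ` A) \<longleftrightarrow> p ` F \<in> D"
      by (auto simp: induced_subcomplex_def DB_def B_def)
  qed
  have "Inl ` A \<subseteq> B" by (simp add: B_def)
  from weakly_homogeneous_complex_any_type[OF hom finB DB this _ iso] A
  obtain g U where U: "U \<subseteq> V" and g: "complex_isomorphism g B DB U (induced_subcomplex D U)"
    and gp: "\<forall>a\<in>Inl ` A. g a = p a" by blast
  have bij: "bij_betw g B U" and gD: "\<And>F. F \<subseteq> B \<Longrightarrow> F \<in> DB \<longleftrightarrow> g ` F \<in> D"
    using g unfolding complex_isomorphism_induced_iff by auto
  have inj: "inj_on g B" using bij by (rule bij_betw_imp_inj_on)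
  have gA: "g (Inl a) = a" if "a \<in> A" for a
    using gp that by (simp add: p_def)
  define L where "L = g ` Inr ` {..<n}"
  have "inj_on g (Inr ` {..<n})"
    using inj by (rule inj_on_subset) (auto simp: B_def)
  then have "card L = n" by (simp add: L_def card_image)
  moreover have "L \<subseteq> V" using U bij by (auto simp: L_def B_def bij_betw_def)
  moreover have "L \<inter> A = {}"
  proof -
    \<comment> \<open>As \<open>g\<close> sends \<open>Inl a\<close> to \<open>a\<close>, a new
      vertex landing in \<open>A\<close> would share its value with an \<open>Inl\<close> vertex,
      against injectivity.\<close>
    have False if "i < n" "g (Inr i) \<in> A" for i
    proof -
      have "g (Inr i) = g (Inl (g (Inr i)))" using gA[OF that(2)] by simp
      then show False using inj that by (auto simp: B_def dest!: inj_onD)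
    qed
    then show ?thesis by (auto simp: L_def)
  qed
  moreover have "F \<union> L \<in> D" if "F \<in> D" "F \<subseteq> A" for F
  proof -
    let ?F = "Inl ` F \<union> Inr ` {..<n} :: ('a + nat) set"
    have "Inl -` ?F = F" by auto
    then have "?F \<in> DB" using that by (auto simp: DB_def B_def)
    then have "g ` ?F \<in> D" using gD[of ?F] by (auto simp: DB_def)
    moreover have "g ` Inl ` F = F" using gA that(2) by (force simp: image_image)
    ultimately show ?thesis by (simp add: image_Un L_def)
  qed
  ultimately show "\<exists>L. finite L \<and> card L = n \<and> L \<subseteq> V \<and> L \<inter> A = {} \<and> (\<forall>F\<in>D. F \<subseteq> A \<longrightarrow> F \<union> L \<in> D)"
    by (intro exI[of _ L]) (auto simp: L_def)
qed

section \<open>Extending embeddings of compact sets\<close>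

text \<open>Compactness of \<open>Y\<close> enters through closedness: Tietze applies, and the
  distance to a nonempty \<open>Y\<close> vanishes exactly on \<open>Y\<close>.\<close>

lemma extend_embedding:
  fixes f :: "('b \<Rightarrow>\<^sub>0 real) \<Rightarrow> ('a \<Rightarrow>\<^sub>0 real)"
  assumes join: "joinable_complex V D" and E: "abstract_simplicial_complex W E"
    and A: "finite A" "A \<subseteq> V" and B: "finite B"
    and Y: "compact Y" "Y \<subseteq> realisation_on E B"
    and f: "continuous_on Y f" "inj_on f Y" "f ` Y \<subseteq> realisation_on D A"
  obtains A' g where "finite A'" "A \<subseteq> A'" "A' \<subseteq> V"
    "continuous_on (realisation_on E B) g" "inj_on g (realisation_on E B)"
    "g ` realisation_on E B \<subseteq> realisation_on D A'" "\<And>y. y \<in> Y \<Longrightarrow> g y = f y"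
proof -
  let ?Z = "realisation_on E B"
  have D: "abstract_simplicial_complex V D" using join by (simp add: joinable_complex_def)
  have down: "G \<in> D" if "F \<in> D" "G \<subseteq> F" for F G
    using D that unfolding abstract_simplicial_complex_def by blast
  have "\<exists>L. finite L \<and> card L = card B \<and> L \<subseteq> V \<and> L \<inter> A = {} \<and> (\<forall>F\<in>D. F \<subseteq> A \<longrightarrow> F \<union> L \<in> D)"
    using join A by (simp add: joinable_complex_def)
  then obtain L where L: "finite L" "card L = card B" "L \<subseteq> V" "L \<inter> A = {}"
    and LD: "\<And>F. F \<in> D \<Longrightarrow> F \<subseteq> A \<Longrightarrow> F \<union> L \<in> D" by blast
  \<comment> \<open>Each vertex of \<open>L\<close> will carry one barycentric coordinate of
    \<open>z\<close>; this is why \<open>L\<close> has the size of \<open>B\<close>.\<close>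
  obtain \<beta> where \<beta>: "bij_betw \<beta> L B"
    using finite_same_card_bij[OF L(1) B L(2)] by blast
  have Z: "Poly_Mapping.keys z \<subseteq> B" "\<And>v. 0 \<le> Poly_Mapping.lookup z v"
    "sum (Poly_Mapping.lookup z) B = 1" if "z \<in> ?Z" for z
    using that by (auto simp: realisation_on_iff[OF E B])
  have fY: "Poly_Mapping.keys (f y) \<in> D" "Poly_Mapping.keys (f y) \<subseteq> A"
    "\<And>v. 0 \<le> Poly_Mapping.lookup (f y) v" "sum (Poly_Mapping.lookup (f y)) A = 1" if "y \<in> Y" for y
    using subsetD[OF f(3) imageI[OF that]] by (simp_all add: realisation_on_iff[OF D A(1)])

  \<comment> \<open>Each coordinate is extended separately with values in the nonnegative reals. Off
    \<open>Y\<close> neither the support nor the sum of the extensions is controlled; truncation and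
    normalisation repair this.\<close>
  have "\<exists>c. continuous_on UNIV c \<and> (\<forall>z. 0 \<le> c z) \<and> (\<forall>y\<in>Y. c y = Poly_Mapping.lookup (f y) v)" for v
  proof (rule Tietze_extension_realinterval[of euclidean Y "{0..}" "\<lambda>y. Poly_Mapping.lookup (f y) v"])
    show "normal_space (euclidean :: ('b \<Rightarrow>\<^sub>0 real) topology)"
      by (intro metrizable_imp_normal_space metrizable_space_euclidean)
    show "closedin euclidean Y" using Y(1) by (simp add: compact_imp_closed)
    show "is_interval {0::real..}" by (rule is_interval_ci)
    show "continuous_map (top_of_set Y) euclideanreal (\<lambda>y. Poly_Mapping.lookup (f y) v)"
      using f(1) by (simp add: continuous_on_lookup)
    show "(\<lambda>y. Poly_Mapping.lookup (f y) v) ` Y \<subseteq> {0..}" using fY(3) by auto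
    fix g assume "continuous_map euclidean euclideanreal g" "g ` topspace euclidean \<subseteq> {0..}"
      "\<And>x. x \<in> Y \<Longrightarrow> g x = Poly_Mapping.lookup (f x) v"
    then show ?thesis by (intro exI[of _ g]) auto
  qed auto
  then obtain c where c: "\<And>v. continuous_on UNIV (c v)" "\<And>v z. 0 \<le> c v z"
    "\<And>v y. y \<in> Y \<Longrightarrow> c v y = Poly_Mapping.lookup (f y) v" by metis

  define \<N> where "\<N> = {N. N \<subseteq> A \<and> N \<notin> D}"
  have fin\<N>: "finite \<N>" unfolding \<N>_def using A(1) by simp
  have \<N>: "finite N" "N \<noteq> {}" if "N \<in> \<N>" for N
    using that D A(1) by (auto simp: \<N>_def abstract_simplicial_complex_def intro: finite_subset)
  \<comment> \<open>Exceeding \<open>\<epsilon> z\<close> singles out a face, whereas \<open>\<epsilon>\<close> vanishes where the coordinates form a point of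
    the realisation: so subtracting \<open>\<epsilon>\<close> pushes the Tietze extension into the cone over the realisation
    without moving it on \<open>Y\<close>.\<close>
  define \<epsilon> where "\<epsilon> z = (\<Sum>N\<in>\<N>. Min ((\<lambda>v. c v z) ` N))" for z
  have Min_nonneg: "0 \<le> Min ((\<lambda>v. c v z) ` N)" if "N \<in> \<N>" for N z
    using \<N>[OF that] c(2) by simp
  have cont\<epsilon>: "continuous_on UNIV \<epsilon>"
    unfolding \<epsilon>_def using \<N> c(1) by (intro continuous_on_sum continuous_on_Min_image) auto
  \<comment> \<open>The support of \<open>f y\<close> is a face and so contains no non-face: every
    \<open>N\<close> has a vertex with coordinate 0, which makes its minimum 0.\<close>
  have \<epsilon>Y: "\<epsilon> y = 0" if y: "y \<in> Y" for y
    unfolding \<epsilon>_def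
  proof (intro sum.neutral ballI)
    fix N assume N: "N \<in> \<N>"
    have "\<not> N \<subseteq> Poly_Mapping.keys (f y)"
      using N down[OF fY(1)[OF y]] by (auto simp: \<N>_def)
    then obtain v where v: "v \<in> N" "c v y = 0"
      using c(3)[OF y] by (auto simp: in_keys_iff)
    then have "Min ((\<lambda>v. c v y) ` N) \<le> 0"
      using \<N>[OF N] by (metis (no_types, lifting) Min_le finite_imageI imageI)
    then show "Min ((\<lambda>v. c v y) ` N) = 0" using Min_nonneg[OF N, of y] by linarith
  qed
  \<comment> \<open>Were this set a non-face, the minimum of its coordinates would be a summand of
    \<open>\<epsilon> z\<close>, yet exceed \<open>\<epsilon> z\<close>.\<close>
  have large_face: "{v \<in> A. \<epsilon> z < c v z} \<in> D" for z
  proof (rule ccontr)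
    let ?N = "{v \<in> A. \<epsilon> z < c v z}"
    assume "?N \<notin> D"
    then have N: "?N \<in> \<N>" by (auto simp: \<N>_def)
    have "\<epsilon> z < Min ((\<lambda>v. c v z) ` ?N)"
      using \<N>[OF N] by (subst Min_gr_iff) auto
    also have "\<dots> \<le> (\<Sum>N\<in>\<N>. Min ((\<lambda>v. c v z) ` N))"
      using Min_nonneg by (intro member_le_sum[OF N _ fin\<N>]) auto
    also have "\<dots> = \<epsilon> z" by (simp only: \<epsilon>_def)
    finally show False by simp
  qed

  \<comment> \<open>The case distinction is needed because \<open>infdist z {} = 0\<close>.\<close>
  define \<phi> where "\<phi> z = (if Y = {} then 1 else infdist z Y)" for z
  have \<phi>: "0 \<le> \<phi> z" "\<phi> z = 0 \<longleftrightarrow> z \<in> Y" for z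
    using in_closed_iff_infdist_zero[of Y z] Y(1)
    by (auto simp: \<phi>_def infdist_nonneg compact_imp_closed)
  have cont\<phi>: "continuous_on UNIV \<phi>"
    by (cases "Y = {}") (auto simp: \<phi>_def intro!: continuous_intros)

  define w where
    "w v z = (if v \<in> A then max (c v z - \<epsilon> z) 0 else \<phi> z * Poly_Mapping.lookup z (\<beta> v))" for v z
  define m where "m z = (\<Sum>v\<in>A \<union> L. w v z)" for z
  define g where "g z = point_of (A \<union> L) (\<lambda>v. w v z / m z)" for z
  have finAL: "finite (A \<union> L)" using A L by simp
  have contw: "continuous_on ?Z (w v)" for v
  proof (cases "v \<in> A")
    case True
    have "continuous_on UNIV (\<lambda>z. max (c v z - \<epsilon> z) 0)"
      using c(1) cont\<epsilon> by (intro continuous_intros)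
    then show ?thesis using True by (auto simp: w_def intro: continuous_on_subset)
  next
    case False
    have "continuous_on UNIV (\<lambda>z. \<phi> z * Poly_Mapping.lookup z (\<beta> v))"
      using cont\<phi> by (intro continuous_intros)
    then show ?thesis using False by (auto simp: w_def intro: continuous_on_subset)
  qed
  have w_nonneg: "0 \<le> w v z" if "z \<in> ?Z" for v z
    using Z[OF that] \<phi>(1) by (simp add: w_def)
  have w_A: "w v y = Poly_Mapping.lookup (f y) v" if "y \<in> Y" "v \<in> A" for v y
    using that \<epsilon>Y c(3) fY(3) by (simp add: w_def)
  have w_L: "w v z = \<phi> z * Poly_Mapping.lookup z (\<beta> v)" if "v \<in> L" for v z
    using that L(4) by (auto simp: w_def)
  \<comment> \<open>The coordinates of \<open>z\<close> sum to 1, so the total weight on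
    \<open>L\<close> is \<open>\<phi> z\<close>. Hence the normaliser \<open>m\<close> is 1 on
    \<open>Y\<close>, and it is positive off \<open>Y\<close> even where truncation kills all
    \<open>A\<close>-coordinates.\<close>
  have m_eq: "m z = (\<Sum>v\<in>A. w v z) + \<phi> z" if "z \<in> ?Z" for z
  proof -
    have "(\<Sum>v\<in>L. w v z) = \<phi> z * (\<Sum>v\<in>L. Poly_Mapping.lookup z (\<beta> v))"
      by (simp add: w_L sum_distrib_left)
    also have "(\<Sum>v\<in>L. Poly_Mapping.lookup z (\<beta> v)) = 1"
      using sum.reindex_bij_betw[OF \<beta>, of "Poly_Mapping.lookup z"] Z(3)[OF that] by simp
    finally have "(\<Sum>v\<in>L. w v z) = \<phi> z" by simp
    moreover have "m z = (\<Sum>v\<in>A. w v z) + (\<Sum>v\<in>L. w v z)"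
      unfolding m_def using A L by (intro sum.union_disjoint) auto
    ultimately show ?thesis by simp
  qed
  have m_Y: "m y = 1" if "y \<in> Y" for y
    using that m_eq[of y] Y(2) \<phi>(2) fY(4) w_A by (auto simp: subset_iff)
  have m_pos: "0 < m z" if "z \<in> ?Z" for z
  proof (cases "z \<in> Y")
    case False
    then have "0 < \<phi> z" using \<phi>[of z] by linarith
    moreover have "0 \<le> (\<Sum>v\<in>A. w v z)" using w_nonneg[OF that] by (simp add: sum_nonneg)
    ultimately show ?thesis using m_eq[OF that] by linarith
  qed (simp add: m_Y)
  have lookup_g: "Poly_Mapping.lookup (g z) v = (if v \<in> A \<union> L then w v z / m z else 0)" for z v
    unfolding g_def by (rule lookup_point_of[OF finAL])

  show thesis
  proof
    show "finite (A \<union> L)" "A \<subseteq> A \<union> L" "A \<union> L \<subseteq> V" using A L by auto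
    have "continuous_on ?Z m"
      unfolding m_def using contw by (intro continuous_on_sum)
    then show "continuous_on ?Z g"
      unfolding g_def point_of_def using contw m_pos
      by (intro continuous_on_sum continuous_on_scaleR continuous_on_divide continuous_on_const)
        (auto simp: less_imp_neq[THEN not_sym])
    show gY: "g y = f y" if y: "y \<in> Y" for y
    proof (rule poly_mapping_eqI)
      fix v
      have "Poly_Mapping.lookup (f y) v = 0" if "v \<notin> A"
        using fY(2)[OF y] that by (auto simp: in_keys_iff)
      moreover have "\<phi> y = 0" using \<phi>(2) y by simp
      ultimately show "Poly_Mapping.lookup (g y) v = Poly_Mapping.lookup (f y) v"
        using y w_A w_L m_Y by (cases "v \<in> A") (auto simp: lookup_g)
    qed
    show "g ` ?Z \<subseteq> realisation_on D (A \<union> L)"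
    proof (clarify)
      fix z assume z: "z \<in> ?Z"
      have keys: "Poly_Mapping.keys (g z) \<subseteq> {v \<in> A. \<epsilon> z < c v z} \<union> L"
        by (auto simp: in_keys_iff lookup_g w_def split: if_splits)
      have "{v \<in> A. \<epsilon> z < c v z} \<union> L \<in> D" by (rule LD[OF large_face]) auto
      then have "Poly_Mapping.keys (g z) \<in> D" using keys by (rule down)
      moreover have "sum (Poly_Mapping.lookup (g z)) (A \<union> L) = (\<Sum>v\<in>A \<union> L. w v z / m z)"
        by (intro sum.cong) (auto simp: lookup_g)
      moreover have "\<dots> = 1"
        using m_pos[OF z] by (simp add: sum_divide_distrib[symmetric] m_def)
      moreover have "0 \<le> Poly_Mapping.lookup (g z) v" for v
        using w_nonneg[OF z] m_pos[OF z] by (simp add: lookup_g)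
      ultimately show "g z \<in> realisation_on D (A \<union> L)"
        using keys by (auto simp: realisation_on_iff[OF D finAL])
    qed
    show "inj_on g ?Z"
    proof (rule inj_onI)
      fix z z' assume z: "z \<in> ?Z" "z' \<in> ?Z" and eq: "g z = g z'"
      \<comment> \<open>This is the total weight of \<open>g x\<close> on \<open>L\<close>, so it is
        determined by \<open>g x\<close>. It vanishes exactly on \<open>Y\<close>, where injectivity
        of \<open>f\<close> takes over; elsewhere dividing by it recovers the coordinates of
        \<open>x\<close>.\<close>
      define q where "q x = \<phi> x / m x" for x
      have q0: "q x = 0 \<longleftrightarrow> x \<in> Y" if "x \<in> ?Z" for x
        using m_pos[OF that] \<phi>(2) by (simp add: q_def)
      have lk: "q z * Poly_Mapping.lookup z b = q z' * Poly_Mapping.lookup z' b" if b: "b \<in> B" for b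
      proof -
        obtain v where v: "v \<in> L" "b = \<beta> v" using b \<beta> by (auto simp: bij_betw_def)
        have "Poly_Mapping.lookup (g z) v = Poly_Mapping.lookup (g z') v" using eq by simp
        then show ?thesis using v by (simp add: lookup_g w_L q_def)
      qed
      have "q z * sum (Poly_Mapping.lookup z) B = q z' * sum (Poly_Mapping.lookup z') B"
        unfolding sum_distrib_left by (rule sum.cong[OF refl lk])
      then have q: "q z = q z'" using Z(3) z by simp
      show "z = z'"
      proof (cases "z \<in> Y")
        case True
        then have "z' \<in> Y" using q q0[OF z(1)] q0[OF z(2)] by simp
        then show ?thesis using True eq gY f(2) by (auto dest: inj_onD)
      next
        case False
        then have "q z \<noteq> 0" using q0[OF z(1)] by simp
        then have "Poly_Mapping.lookup z b = Poly_Mapping.lookup z' b" if "b \<in> B" for b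
          using lk[OF that] q by simp
        moreover have "Poly_Mapping.lookup z b = 0 \<and> Poly_Mapping.lookup z' b = 0" if "b \<notin> B" for b
          using that Z(1)[OF z(1)] Z(1)[OF z(2)] by (auto simp: in_keys_iff)
        ultimately show ?thesis by (metis poly_mapping_eqI)
      qed
    qed
  qed
qed

text \<open>The half-step of the back-and-forth. By compactness the inverse of \<open>f\<close> is
  continuous on the image of \<open>f\<close>, hence an embedding of a compact set that
  \<open>extend_embedding\<close> can extend.\<close>

lemma extend_inverse:
  fixes f :: "('a \<Rightarrow>\<^sub>0 real) \<Rightarrow> ('b \<Rightarrow>\<^sub>0 real)"
  assumes join: "joinable_complex V D" and E: "abstract_simplicial_complex W E"
    and A: "finite A" "A \<subseteq> V" and B: "finite B"
    and f: "continuous_on (realisation_on D A) f" "inj_on f (realisation_on D A)"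
      "f ` realisation_on D A \<subseteq> realisation_on E B"
  obtains A' g where "finite A'" "A \<subseteq> A'" "A' \<subseteq> V"
    "continuous_on (realisation_on E B) g" "inj_on g (realisation_on E B)"
    "g ` realisation_on E B \<subseteq> realisation_on D A'" "\<And>x. x \<in> realisation_on D A \<Longrightarrow> g (f x) = x"
proof -
  let ?X = "realisation_on D A"
  define k where "k = inv_into ?X f"
  have kf: "\<forall>x\<in>?X. k (f x) = x" using f(2) by (simp add: k_def)
  have X: "compact ?X"
    using join A(1) by (auto simp: joinable_complex_def intro: compact_realisation_on)
  have "continuous_on (f ` ?X) k" using f(1) X kf by (rule continuous_on_inv)
  moreover have "inj_on k (f ` ?X)" using kf by (auto intro: inj_onI)
  moreover have "k ` f ` ?X \<subseteq> ?X" using kf by auto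
  moreover have "compact (f ` ?X)" using f(1) X by (rule compact_continuous_image)
  ultimately obtain A' g where "finite A'" "A \<subseteq> A'" "A' \<subseteq> V"
    "continuous_on (realisation_on E B) g" "inj_on g (realisation_on E B)"
    "g ` realisation_on E B \<subseteq> realisation_on D A'" "\<And>y. y \<in> f ` ?X \<Longrightarrow> g y = k y"
    using extend_embedding[OF join E A B _ f(3)] by metis
  then show thesis using that[of A' g] kf by simp
qed

section \<open>Continuity in the colimit topology\<close>

text \<open>Openness is tested on finite stages on both sides. The finite \<open>T\<close> supplies
  a stage of the target in which the open set can be tested and then pulled back.\<close>

lemma continuous_map_geometric_realisation:
  assumes "h ` realisation_set D \<subseteq> realisation_set E"
    and "\<And>S. finite S \<Longrightarrow> S \<subseteq> V \<Longrightarrow> continuous_on (realisation_on D S) h \<and>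
           (\<exists>T. finite T \<and> T \<subseteq> W \<and> h ` realisation_on D S \<subseteq> realisation_on E T)"
  shows "continuous_map (geometric_realisation V D) (geometric_realisation W E) h"
  unfolding continuous_map_def topspace_geometric_realisation
proof (intro conjI allI impI)
  show "h \<in> realisation_set D \<rightarrow> realisation_set E" using assms(1) by auto
  fix U assume U: "openin (geometric_realisation W E) U"
  show "openin (geometric_realisation V D) {x \<in> realisation_set D. h x \<in> U}"
    unfolding openin_geometric_realisation
  proof (intro conjI allI impI)
    fix S assume S: "finite S \<and> S \<subseteq> V"
    then obtain T where T: "finite T" "T \<subseteq> W" "h ` realisation_on D S \<subseteq> realisation_on E T"
      using assms(2)[of S] by auto
    have open_T: "openin (top_of_set (realisation_on E T)) (U \<inter> coordinate_subspace T)"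
      using U T by (simp add: openin_geometric_realisation realisation_on_def)
    have "continuous_map (top_of_set (realisation_on D S)) (top_of_set (realisation_on E T)) h"
      using assms(2)[of S] S T(3) by (simp add: image_subset_iff_funcset)
    from openin_continuous_map_preimage[OF this open_T]
    have "openin (top_of_set (realisation_on D S))
        {x \<in> realisation_on D S. h x \<in> U \<inter> coordinate_subspace T}"
      by simp
    also have "{x \<in> realisation_on D S. h x \<in> U \<inter> coordinate_subspace T} =
        {x \<in> realisation_set D. h x \<in> U} \<inter> coordinate_subspace S"
      using T(3) by (auto simp: realisation_on_def)
    finally show "openin (top_of_set (realisation_set D \<inter> coordinate_subspace S))
        ({x \<in> realisation_set D. h x \<in> U} \<inter> coordinate_subspace S)"
      by (simp add: realisation_on_def)
  qed auto
qed

text \<open>Nonemptiness is what lets \<open>from_nat_into\<close> enumerate exactly the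
  vertices.\<close>

lemma joinable_complex_nonempty:
  assumes "joinable_complex V D"
  shows "V \<noteq> {}"
proof -
  have "\<exists>L. card L = 1 \<and> L \<subseteq> V"
    using assms unfolding joinable_complex_def by (meson empty_subsetI finite.emptyI)
  then show ?thesis by auto
qed

lemma finite_subset_of_exhaustion:
  fixes C :: "nat \<Rightarrow> 'a set"
  assumes "finite S" "S \<subseteq> range v" "\<And>n. v n \<in> C (Suc n)" "\<And>n m. n \<le> m \<Longrightarrow> C n \<subseteq> C m"
  shows "\<exists>n. S \<subseteq> C n"
  using assms(1,2)
proof induction
  case (insert x S)
  then obtain n where n: "S \<subseteq> C n" by auto
  obtain k where "x = v k" using insert.prems by auto
  then have "x \<in> C (Suc k)" using assms(3) by simp
  then have "insert x S \<subseteq> C (max n (Suc k))"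
    using n assms(4)[of n "max n (Suc k)"] assms(4)[of "Suc k" "max n (Suc k)"] by auto
  then show ?case by blast
qed auto

section \<open>The back-and-forth construction\<close>

theorem joinable_complexes_homeomorphic:
  fixes V :: "'a set" and W :: "'b set"
  assumes D: "joinable_complex V D" "countable V" and E: "joinable_complex W E" "countable W"
  shows "geometric_realisation V D homeomorphic_space geometric_realisation W E"
proof -
  have cD: "abstract_simplicial_complex V D" and cE: "abstract_simplicial_complex W E"
    using D E by (simp_all add: joinable_complex_def)
  have rangeV: "range (from_nat_into V) = V" and rangeW: "range (from_nat_into W) = W"
    using D E by (simp_all add: range_from_nat_into joinable_complex_nonempty)

  define P where "P = (\<lambda>(A, B, f). finite A \<and> A \<subseteq> V \<and> finite B \<and> B \<subseteq> W \<and>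
    continuous_on (realisation_on D A) f \<and> inj_on f (realisation_on D A) \<and>
    f ` realisation_on D A \<subseteq> realisation_on E B)"
  \<comment> \<open>Surjectivity lags one stage behind: \<open>f'\<close> must cover the stage over
    the old \<open>B\<close>, since it need not fill the one over \<open>B'\<close>.\<close>
  define Q where "Q = (\<lambda>n (A, B, f) (A', B', f'). A \<subseteq> A' \<and> B \<subseteq> B' \<and>
    from_nat_into V n \<in> A' \<and> from_nat_into W n \<in> B' \<and>
    (\<forall>x\<in>realisation_on D A. f' x = f x) \<and> realisation_on E B \<subseteq> f' ` realisation_on D A')"
  have "\<exists>s. \<forall>n. P (s n) \<and> Q n (s n) (s (Suc n))"
  proof (rule dependent_nat_choice)
    show "\<exists>s. P s"
      \<comment> \<open>The stage over no vertices is empty, so any function serves as the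
        start.\<close>
      by (rule exI[of _ "({}, {}, \<lambda>_. 0)"]) (simp add: P_def realisation_on_empty[OF cD])
    fix s n assume "P s"
    moreover obtain A B f where s: "s = (A, B, f)" by (cases s)
    ultimately have A: "finite A" "A \<subseteq> V" and B: "finite B" "B \<subseteq> W"
      and f: "continuous_on (realisation_on D A) f" "inj_on f (realisation_on D A)"
        "f ` realisation_on D A \<subseteq> realisation_on E B"
      by (auto simp: P_def)
    define B1 where "B1 = insert (from_nat_into W n) B"
    have B1: "finite B1" "B1 \<subseteq> W" "B \<subseteq> B1" using B rangeW by (auto simp: B1_def)
    have f1: "f ` realisation_on D A \<subseteq> realisation_on E B1"
      using f(3) realisation_on_mono[OF B1(3)] by blast
    obtain A' g where A': "finite A'" "A \<subseteq> A'" "A' \<subseteq> V" and g: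
      "continuous_on (realisation_on E B1) g" "inj_on g (realisation_on E B1)"
      "g ` realisation_on E B1 \<subseteq> realisation_on D A'"
      "\<And>x. x \<in> realisation_on D A \<Longrightarrow> g (f x) = x"
      by (rule extend_inverse[OF D(1) cE A B1(1) f(1,2) f1]) (rule that)
    define A1 where "A1 = insert (from_nat_into V n) A'"
    have A1: "finite A1" "A1 \<subseteq> V" "A' \<subseteq> A1" using A' rangeV by (auto simp: A1_def)
    have g1: "g ` realisation_on E B1 \<subseteq> realisation_on D A1"
      using g(3) realisation_on_mono[OF A1(3)] by blast
    obtain B' f' where B': "finite B'" "B1 \<subseteq> B'" "B' \<subseteq> W" and f':
      "continuous_on (realisation_on D A1) f'" "inj_on f' (realisation_on D A1)"
      "f' ` realisation_on D A1 \<subseteq> realisation_on E B'"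
      "\<And>y. y \<in> realisation_on E B1 \<Longrightarrow> f' (g y) = y"
      by (rule extend_inverse[OF E(1) cD B1(1,2) A1(1) g(1,2) g1]) (rule that)
    \<comment> \<open>Here \<open>x = g (f x)\<close>, and \<open>f'\<close> undoes \<open>g\<close>
      at \<open>f x\<close>. The same left inverse property puts every \<open>y\<close> of the stage
      over \<open>B1\<close> in the image, as \<open>f' (g y)\<close>.\<close>
    have "f' x = f x" if "x \<in> realisation_on D A" for x
      using f'(4)[of "f x"] g(4)[OF that] f1 that by auto
    moreover have "y \<in> f' ` realisation_on D A1" if "y \<in> realisation_on E B" for y
    proof -
      have y: "y \<in> realisation_on E B1" using that realisation_on_mono[OF B1(3)] by blast
      then have "g y \<in> realisation_on D A1" using g1 by blast
      then show ?thesis using f'(4)[OF y] by (metis imageI)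
    qed
    ultimately have "P (A1, B', f') \<and> Q n s (A1, B', f')"
      using A1 B' f' A' B1 by (auto simp: P_def Q_def s A1_def B1_def)
    then show "\<exists>s'. P s' \<and> Q n s s'" by blast
  qed
  then obtain s where s: "\<And>n. P (s n)" "\<And>n. Q n (s n) (s (Suc n))" by blast
  define A where "A n = fst (s n)" for n
  define B where "B n = fst (snd (s n))" for n
  define f where "f n = snd (snd (s n))" for n
  have s_eq: "s n = (A n, B n, f n)" for n by (simp add: A_def B_def f_def)
  have A: "finite (A n)" "A n \<subseteq> V" and B: "finite (B n)" "B n \<subseteq> W"
    and f: "continuous_on (realisation_on D (A n)) (f n)" "inj_on (f n) (realisation_on D (A n))"
      "f n ` realisation_on D (A n) \<subseteq> realisation_on E (B n)" for n
    using s(1)[of n] by (simp_all add: P_def s_eq)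
  have f_Suc: "\<And>x. x \<in> realisation_on D (A n) \<Longrightarrow> f (Suc n) x = f n x"
    and step: "A n \<subseteq> A (Suc n)" "B n \<subseteq> B (Suc n)"
    "from_nat_into V n \<in> A (Suc n)" "from_nat_into W n \<in> B (Suc n)"
    "realisation_on E (B n) \<subseteq> f (Suc n) ` realisation_on D (A (Suc n))" for n
    using s(2)[of n] by (simp_all add: Q_def s_eq)
  have A_mono: "A n \<subseteq> A m" if "n \<le> m" for n m
    using that step(1) by (rule lift_Suc_mono_le[rotated])
  have B_mono: "B n \<subseteq> B m" if "n \<le> m" for n m
    using that step(2) by (rule lift_Suc_mono_le[rotated])
  have exA: "\<exists>n. S \<subseteq> A n" if "finite S" "S \<subseteq> V" for S
    by (rule finite_subset_of_exhaustion[where v = "from_nat_into V"])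
      (use that rangeV step(3) A_mono in auto)
  have exB: "\<exists>n. S \<subseteq> B n" if "finite S" "S \<subseteq> W" for S
    by (rule finite_subset_of_exhaustion[where v = "from_nat_into W"])
      (use that rangeW step(4) B_mono in auto)
  have keysD: "\<exists>n. x \<in> realisation_on D (A n)" if "x \<in> realisation_set D" for x
  proof -
    have "Poly_Mapping.keys x \<subseteq> V"
      using that cD by (auto simp: realisation_set_iff[OF cD] abstract_simplicial_complex_def)
    then obtain n where "Poly_Mapping.keys x \<subseteq> A n" using exA[OF finite_keys] by blast
    then show ?thesis using that by (auto simp: realisation_on_def coordinate_subspace_def)
  qed
  have keysE: "\<exists>n. y \<in> realisation_on E (B n)" if "y \<in> realisation_set E" for y
  proof -
    have "Poly_Mapping.keys y \<subseteq> W"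
      using that cE by (auto simp: realisation_set_iff[OF cE] abstract_simplicial_complex_def)
    then obtain n where "Poly_Mapping.keys y \<subseteq> B n" using exB[OF finite_keys] by blast
    then show ?thesis using that by (auto simp: realisation_on_def coordinate_subspace_def)
  qed

  have f_le: "f m x = f n x" if "n \<le> m" "x \<in> realisation_on D (A n)" for n m x
    using that(1)
  proof (induction m rule: dec_induct)
    case (step k)
    have "x \<in> realisation_on D (A k)"
      using that(2) realisation_on_mono[OF A_mono[OF step.hyps(1)]] by blast
    then show ?case using step.IH f_Suc by simp
  qed simp
  \<comment> \<open>The least stage is a mere choice: by \<open>f_le\<close> every stage containing
    \<open>x\<close> gives the same value.\<close>
  define h where "h x = f (LEAST n. x \<in> realisation_on D (A n)) x" for x
  have h: "h x = f n x" if "x \<in> realisation_on D (A n)" for x n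
    unfolding h_def using LeastI[of "\<lambda>n. x \<in> realisation_on D (A n)", OF that]
      Least_le[of "\<lambda>n. x \<in> realisation_on D (A n)", OF that] by (rule f_le[symmetric, rotated])
  have h_image: "h ` realisation_on D (A n) \<subseteq> realisation_on E (B n)" for n
    using f(3)[of n] h by auto
  have h_into: "h ` realisation_set D \<subseteq> realisation_set E"
    using keysD h_image realisation_on_subset by blast
  have h_cont: "continuous_on (realisation_on D (A n)) h" for n
    using f(1)[of n] h by (simp cong: continuous_on_cong)
  have h_inj: "inj_on h (realisation_set D)"
  proof (rule inj_onI)
    fix x y assume xy: "x \<in> realisation_set D" "y \<in> realisation_set D" "h x = h y"
    then obtain n m where "x \<in> realisation_on D (A n)" "y \<in> realisation_on D (A m)"
      using keysD by blast
    then have "x \<in> realisation_on D (A (max n m))" "y \<in> realisation_on D (A (max n m))"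
      using realisation_on_mono[OF A_mono[of n "max n m"]] realisation_on_mono[OF A_mono[of m "max n m"]]
      by auto
    then show "x = y" using f(2)[of "max n m"] xy(3) h by (auto dest: inj_onD)
  qed
  have h_onto: "realisation_on E (B n) \<subseteq> h ` realisation_on D (A (Suc n))" for n
    using step(5)[of n] h by force
  define k where "k = inv_into (realisation_set D) h"
  have kh: "k (h x) = x" if "x \<in> realisation_set D" for x
    using that h_inj by (simp add: k_def)
  have hk: "h (k y) = y" if y: "y \<in> realisation_set E" for y
  proof -
    obtain x where "x \<in> realisation_set D" "y = h x" using keysE[OF y] h_onto realisation_on_subset by blast
    then show ?thesis by (simp add: kh)
  qed
  have k_image: "k ` realisation_on E (B n) \<subseteq> realisation_on D (A (Suc n))" for n
    using h_onto[of n] kh realisation_on_subset by fastforce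
  \<comment> \<open>The stage over \<open>B n\<close> lies in the image under \<open>h\<close> of
    the compact stage over \<open>A (Suc n)\<close>, where the inverse of the continuous injection
    \<open>h\<close> is continuous.\<close>
  have k_cont: "continuous_on (realisation_on E (B n)) k" for n
  proof -
    have "\<forall>x\<in>realisation_on D (A (Suc n)). k (h x) = x" using kh realisation_on_subset by blast
    then have "continuous_on (h ` realisation_on D (A (Suc n))) k"
      using continuous_on_inv h_cont compact_realisation_on[OF cD A(1)] by blast
    then show ?thesis using h_onto by (rule continuous_on_subset)
  qed
  have "continuous_map (geometric_realisation V D) (geometric_realisation W E) h"
  proof (rule continuous_map_geometric_realisation[OF h_into])
    fix S assume "finite S" "S \<subseteq> V"
    then obtain n where "S \<subseteq> A n" using exA by blast
    from realisation_on_mono[OF this, of D]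
    show "continuous_on (realisation_on D S) h \<and>
        (\<exists>T. finite T \<and> T \<subseteq> W \<and> h ` realisation_on D S \<subseteq> realisation_on E T)"
      using h_cont[of n] h_image[of n] B[of n] by (meson continuous_on_subset image_mono order_trans)
  qed
  moreover have "continuous_map (geometric_realisation W E) (geometric_realisation V D) k"
  proof (rule continuous_map_geometric_realisation)
    show "k ` realisation_set E \<subseteq> realisation_set D"
      using keysE k_image realisation_on_subset by blast
    fix S assume "finite S" "S \<subseteq> W"
    then obtain n where "S \<subseteq> B n" using exB by blast
    from realisation_on_mono[OF this, of E]
    show "continuous_on (realisation_on E S) k \<and>
        (\<exists>T. finite T \<and> T \<subseteq> V \<and> k ` realisation_on E S \<subseteq> realisation_on D T)"
      using k_cont[of n] k_image[of n] A[of "Suc n"]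
      by (meson continuous_on_subset image_mono order_trans)
  qed
  ultimately have "homeomorphic_maps (geometric_realisation V D) (geometric_realisation W E) h k"
    unfolding homeomorphic_maps_def topspace_geometric_realisation using kh hk by blast
  then show ?thesis unfolding homeomorphic_space_def by blast
qed

theorem theorem7p4:
  fixes V :: "'a set" and R_SC :: "'a set set"
  assumes "infinite_random_complex V R_SC"
  shows "geometric_realisation V R_SC homeomorphic_space
         geometric_realisation (UNIV :: nat set) infinite_simplex"
proof (rule joinable_complexes_homeomorphic)
  show "joinable_complex V R_SC"
    using assms by (rule joinable_infinite_random_complex)
  show "countable V"
    using assms by (simp add: infinite_random_complex_def)
qed (auto intro: joinable_infinite_simplex)

end
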